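(* Let $\langle\cdot,\cdot\rangle$ be an ELT inner product on $\overline{\mathcal R}^{\,n}$ and let $u,v\in\overline{\mathcal R}^{\,n}$. Then $$\tau\left(\langle u,v\rangle^2\right)\leq\tau\left(\langle u,u\rangle\cdot\langle v,v\rangle\right).$$
   Context: The ELT algebra $\mathcal R=\mathscr R(\mathbb C,\mathbb R)$ is the set of symbols ${}^{[\ell]}a$ with $a\in\mathbb R$ (tangible value) and $\ell\in\mathbb C$ (layer), with multiplication ${}^{[\ell_1]}a_1\cdot{}^{[\ell_2]}a_2={}^{[\ell_1\ell_2]}(a_1+a_2)$ and addition ${}^{[\ell_1]}a_1+{}^{[\ell_2]}a_2$ equal to ${}^{[\ell_1]}a_1$ if $a_1>a_2$, to ${}^{[\ell_2]}a_2$ if $a_1<a_2$, and to ${}^{[\ell_1+\ell_2]}a_1$ if $a_1=a_2$. Put $\overline{\mathcal R}=\mathcal R\cup\{-\infty\}$, where $-\infty$ is a formal element with $-\infty+\alpha=\alpha+(-\infty)=\alpha$ and $-\infty\cdot\alpha=\alpha\cdot(-\infty)=-\infty$ for all $\alpha$. Layer map: $s({}^{[\ell]}a)=\ell$, $s(-\infty)=0$. Tangible value map: $\tau({}^{[\ell]}a)=a$, $\tau(-\infty)=-\infty$ (with $-\infty$ below every real number). Let $\mathcal R^\times=\{{}^{[\ell]}a\in\mathcal R:\ell\ne0\}$ and $\overline{\mathcal R^\times}=\mathcal R^\times\cup\{-\infty\}$. Conjugation: $\overline{{}^{[\ell]}a}={}^{[\overline\ell]}a$ and $\overline{-\infty}=-\infty$.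 An ELT inner product is a function $\langle\cdot,\cdot\rangle:\overline{\mathcal R}^{\,n}\times\overline{\mathcal R}^{\,n}\to\overline{\mathcal R}$ such that for all $u,v,w\in\overline{\mathcal R}^{\,n}$ and $a,b\in\overline{\mathcal R}$: (1) $\langle av+bu,w\rangle=a\langle v,w\rangle+b\langle u,w\rangle$; (2) $\langle v,u\rangle=\overline{\langle u,v\rangle}$; (3) $s(\langle v,v\rangle)$ is a real number $\geq0$, and if $v\in(\overline{\mathcal R^\times})^n$ then $s(\langle v,v\rangle)=0$ if and only if $v=(-\infty,\dots,-\infty)$. *)

theory Defs
  imports "HOL-Analysis.Finite_Cartesian_Product" "HOL-Library.Extended_Real"
begin

text \<open>
  \<open>Elt l a\<close> is the symbol with layer \<open>l\<close> and tangible value \<open>a\<close>; \<open>NegInf\<close> is the adjoined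
  element \<open>-\<infinity>\<close>. An element of layer \<open>0\<close> is not the same as \<open>NegInf\<close>.
\<close>

datatype elt = NegInf | Elt complex real

primrec layer :: "elt \<Rightarrow> complex" where
  "layer NegInf = 0"
| "layer (Elt l a) = l"

primrec tangible :: "elt \<Rightarrow> ereal" where
  "tangible NegInf = -\<infinity>"
| "tangible (Elt l a) = ereal a"

primrec elt_cnj :: "elt \<Rightarrow> elt" where
  "elt_cnj NegInf = NegInf"
| "elt_cnj (Elt l a) = Elt (cnj l) a"

text \<open>
  \<open>NegInf\<close> is neutral for addition and absorbing for multiplication, so it is the zero of the
  semiring; in particular the zero vector is \<open>(-\<infinity>, \<dots>, -\<infinity>)\<close>.
\<close>

instantiation elt :: comm_semiring_1
begin

definition zero_elt :: elt where "0 = NegInf"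

definition one_elt :: elt where "1 = Elt 1 0"

fun plus_elt :: "elt \<Rightarrow> elt \<Rightarrow> elt" where
  "NegInf + y = y"
| "x + NegInf = x"
| "Elt l1 a1 + Elt l2 a2 =
     (if a1 > a2 then Elt l1 a1 else if a1 < a2 then Elt l2 a2 else Elt (l1 + l2) a1)"

fun times_elt :: "elt \<Rightarrow> elt \<Rightarrow> elt" where
  "NegInf * y = NegInf"
| "x * NegInf = NegInf"
| "Elt l1 a1 * Elt l2 a2 = Elt (l1 * l2) (a1 + a2)"

instance
proof
  fix a b c :: elt
  show "a + b + c = a + (b + c)"
    by (cases a; cases b; cases c) auto
  show "a + b = b + a"
    by (cases a; cases b) auto
  show "0 + a = a"
    by (simp add: zero_elt_def)
  show "a * b * c = a * (b * c)"
    by (cases a; cases b; cases c) auto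
  show "a * b = b * a"
    by (cases a; cases b) auto
  show "1 * a = a"
    by (cases a) (auto simp: one_elt_def)
  show "(a + b) * c = a * c + b * c"
    by (cases a; cases b; cases c) (auto simp: algebra_simps)
  show "0 * a = 0" "a * 0 = 0"
    by (cases a; simp add: zero_elt_def)+
  show "(0::elt) \<noteq> 1"
    by (simp add: zero_elt_def one_elt_def)
qed

end

definition elt_units_bar :: "elt set" where
  "elt_units_bar = insert NegInf {Elt l a |l a. l \<noteq> 0}"

definition elt_inner_product :: "(elt ^ 'n \<Rightarrow> elt ^ 'n \<Rightarrow> elt) \<Rightarrow> bool" where
  "elt_inner_product ip \<longleftrightarrow>
     (\<forall>u v w a b. ip (a *s v + b *s u) w = a * ip v w + b * ip u w) \<and>
     (\<forall>u v. ip v u = elt_cnj (ip u v)) \<and>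
     (\<forall>v. layer (ip v v) \<in> \<real> \<and> Re (layer (ip v v)) \<ge> 0) \<and>
     (\<forall>v. (\<forall>i. v $ i \<in> elt_units_bar) \<longrightarrow>
          (layer (ip v v) = 0 \<longleftrightarrow> v = (\<chi> i. NegInf)))"

end

theory Submission imports Defs begin

text \<open>
  The tangible value turns products into sums and, because layers that cancel do not lower it,
  sums into maxima (lemmas \<open>tangible_times\<close>, \<open>tangible_plus\<close>). Writing \<open>h i j\<close> for the
  tangible value of the inner product of the \<open>i\<close>-th and \<open>j\<close>-th standard basis vectors,
  sesquilinear expansion shows that \<open>\<langle>u, v\<rangle>\<close> has tangible value
  \<open>\<tau> (u $ i) + \<tau> (v $ j) + h i j\<close> for some \<open>i\<close> and \<open>j\<close>
  (lemma \<open>tangible_ip_attained\<close>), whereas \<open>\<langle>u, u\<rangle>\<close> and \<open>\<langle>v, v\<rangle>\<close> have at least the values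
  \<open>2 \<tau> (u $ i) + h i i\<close> and \<open>2 \<tau> (v $ j) + h j j\<close> (lemma \<open>tangible_ip_ge\<close>). The inequality
  therefore reduces to \<open>2 h i j \<le> h i i + h j j\<close>, its own instance for basis vectors.

  This instance comes from definiteness (lemma \<open>cauchy_schwarz_axis\<close>). If
  \<open>2 h i j > h i i + h j j\<close>, then there is a scalar \<open>\<alpha>\<close> whose tangible value makes the two mixed
  terms of \<open>\<langle>\<alpha> e\<^sub>i + e\<^sub>j, \<alpha> e\<^sub>i + e\<^sub>j\<rangle>\<close> dominate both diagonal ones. The mixed terms are conjugate to
  each other, so a suitable phase of \<open>\<alpha>\<close> makes their layers cancel
  (lemma \<open>isotropic_combination\<close>). The resulting vector has all entries in
  \<open>elt_units_bar\<close> and is not zero, but its norm has layer \<open>0\<close>.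
\<close>

section \<open>Tangible values of sums and products\<close>

lemma tangible_plus: "tangible (a + b) = max (tangible a) (tangible b)"
  by (cases a; cases b) (auto simp: max_def)

lemma tangible_times: "tangible (a * b) = tangible a + tangible b"
  by (cases a; cases b) auto

lemma tangible_elt_cnj [simp]: "tangible (elt_cnj a) = tangible a"
  by (cases a) auto

lemma tangible_sum_ge:
  assumes "finite A" "i \<in> A"
  shows "tangible (f i) \<le> tangible (sum f A)"
  using assms by (simp add: sum.remove tangible_plus)

lemma tangible_sum_attained:
  assumes "finite A" "A \<noteq> {}"
  shows "\<exists>i\<in>A. tangible (sum f A) = tangible (f i)"
  using assms
proof (induction rule: finite_ne_induct)
  case (insert x F)
  then show ?case by (auto simp: tangible_plus max_def)
qed simp

section \<open>Expansion along the standard basis\<close>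

lemma axis_one_nth: "axis i (1::elt) $ k = (if k = i then 1 else 0)"
  by (simp add: axis_def)

lemma elt_basis_expansion: "(\<Sum>i\<in>UNIV. u $ i *s axis i 1) = (u :: elt ^ 'n)"
proof (subst vec_eq_iff, intro allI)
  fix k
  have "(\<Sum>i\<in>UNIV. u $ i *s axis i 1) $ k = (\<Sum>i\<in>UNIV. if k = i then u $ i else 0)"
    unfolding sum_component by (intro sum.cong) (auto simp: axis_one_nth)
  then show "(\<Sum>i\<in>UNIV. u $ i *s axis i 1) $ k = u $ k"
    by simp
qed

lemma ip_linear:
  assumes "elt_inner_product ip"
  shows "ip (a *s v + b *s u) w = a * ip v w + b * ip u w"
  using assms unfolding elt_inner_product_def by blast

lemma ip_conj:
  assumes "elt_inner_product ip"
  shows "ip v u = elt_cnj (ip u v)"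
  using assms unfolding elt_inner_product_def by blast

lemma ip_definite:
  assumes "elt_inner_product ip" "\<And>i. v $ i \<in> elt_units_bar" "v $ j \<noteq> 0"
  shows "layer (ip v v) \<noteq> 0"
proof -
  have "v \<noteq> (\<chi> i. NegInf)"
    using assms(3) by (auto simp: zero_elt_def)
  then show ?thesis
    using assms(1,2) unfolding elt_inner_product_def by blast
qed

lemma ip_sum:
  assumes ip: "elt_inner_product ip" and "finite A"
  shows "ip (\<Sum>i\<in>A. c i *s x i) w = (\<Sum>i\<in>A. c i * ip (x i) w)"
  using \<open>finite A\<close>
proof (induction rule: finite_induct)
  case empty
  show ?case using ip_linear[OF ip, of 0 0 0 0 w] by simp
next
  case (insert i A)
  then show ?case
    using ip_linear[OF ip, of "c i" "x i" 1 "\<Sum>i\<in>A. c i *s x i" w] by simp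
qed

lemma ip_expansion:
  assumes "elt_inner_product ip"
  shows "ip u w = (\<Sum>i\<in>UNIV. u $ i * ip (axis i 1) w)"
  using ip_sum[OF assms, of UNIV "\<lambda>i. u $ i" "\<lambda>i. axis i 1" w]
  by (simp add: elt_basis_expansion)

lemma tangible_ip_commute:
  assumes "elt_inner_product ip"
  shows "tangible (ip u v) = tangible (ip v u)"
  using ip_conj[OF assms, of u v] by simp

lemma tangible_ip_ge:
  assumes ip: "elt_inner_product ip"
  shows "tangible (u $ i) + tangible (v $ j) + tangible (ip (axis i 1) (axis j 1))
    \<le> tangible (ip u v)"
proof -
  have le: "tangible (x $ k) + tangible (ip (axis k 1) w) \<le> tangible (ip x w)" for x k w
    using tangible_sum_ge[of UNIV k "\<lambda>k. x $ k * ip (axis k 1) w"]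
    by (simp add: ip_expansion[OF ip, of x] tangible_times)
  have "tangible (v $ j) + tangible (ip (axis i 1) (axis j 1)) \<le> tangible (ip (axis i 1) v)"
    using le[of v j "axis i 1"]
    by (simp only: tangible_ip_commute[OF ip, of "axis i 1"])
  then have "tangible (u $ i) + (tangible (v $ j) + tangible (ip (axis i 1) (axis j 1)))
      \<le> tangible (u $ i) + tangible (ip (axis i 1) v)"
    by (rule add_left_mono)
  then show ?thesis
    using le[of u i v] by (simp add: add.assoc)
qed

lemma tangible_ip_attained:
  assumes ip: "elt_inner_product ip"
  shows "\<exists>i j. tangible (ip u v)
    = tangible (u $ i) + tangible (v $ j) + tangible (ip (axis i 1) (axis j 1))"
proof -
  have eq: "\<exists>k. tangible (ip x w) = tangible (x $ k) + tangible (ip (axis k 1) w)" for x w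
    using tangible_sum_attained[of UNIV "\<lambda>k. x $ k * ip (axis k 1) w"]
    by (simp add: ip_expansion[OF ip, of x] tangible_times)
  obtain i where i: "tangible (ip u v) = tangible (u $ i) + tangible (ip (axis i 1) v)"
    using eq by blast
  obtain j where "tangible (ip v (axis i 1))
      = tangible (v $ j) + tangible (ip (axis j 1) (axis i 1))"
    using eq by blast
  then have "tangible (ip (axis i 1) v)
      = tangible (v $ j) + tangible (ip (axis i 1) (axis j 1))"
    by (simp only: tangible_ip_commute[OF ip, of "axis i 1"])
  with i have "tangible (ip u v)
      = tangible (u $ i) + tangible (v $ j) + tangible (ip (axis i 1) (axis j 1))"
    by (simp only: add.assoc)
  then show ?thesis by blast
qed

section \<open>The inequality for basis vectors\<close>

text \<open>
  The norm of \<open>[l]t x + y\<close> is a sum of four terms, with tangible values \<open>2t + a\<close> and \<open>b\<close> (the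
  diagonal terms) and twice \<open>t + c\<close> (the mixed terms). At \<open>t = (b - a) / 2\<close> both diagonal values
  equal \<open>b\<close>, which lies below \<open>t + c\<close> exactly when \<open>a + b < 2 c\<close>. What remains is the sum of the
  mixed terms, whose layer is \<open>l z + cnj (l z)\<close>.
\<close>

lemma isotropic_combination:
  assumes ip: "elt_inner_product ip"
    and xx: "ip x x = Elt p a" and yy: "ip y y = Elt q b" and xy: "ip x y = Elt z c"
    and less: "a + b < 2 * c"
  shows "\<exists>l t. l \<noteq> 0 \<and> layer (ip (Elt l t *s x + y) (Elt l t *s x + y)) = 0"
proof -
  \<comment> \<open>The phase makes \<open>l * z\<close> purely imaginary, so that it cancels against its conjugate.\<close>
  define l where "l = (if z = 0 then 1 else \<i> * cnj z)"
  define t where "t = (b - a) / 2"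
  define w where "w = Elt l t *s x + y"
  have w: "ip w r = Elt l t * ip x r + ip y r" for r
    using ip_linear[OF ip, of "Elt l t" x 1 y r] by (simp add: w_def)
  have yx: "ip y x = Elt (cnj z) c"
    using ip_conj[OF ip, of y x] xy by simp
  have tc: "t + a < c" "b < t + c" "t + (t + a) < t + c"
    using less by (simp_all add: t_def field_simps)
  have "ip x w = elt_cnj (Elt l t * Elt p a + Elt (cnj z) c)"
    using ip_conj[OF ip, of x w] by (simp add: w xx yx)
  then have xw: "ip x w = Elt z c"
    using tc by simp
  have "ip y w = elt_cnj (Elt l t * Elt z c + Elt q b)"
    using ip_conj[OF ip, of y w] by (simp add: w xy yy)
  then have yw: "ip y w = Elt (cnj (l * z)) (t + c)"
    using tc by simp
  have "layer (ip w w) = l * z + cnj (l * z)"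
    by (simp add: w xw yw)
  also have "\<dots> = 0"
    by (simp add: l_def)
  finally have "layer (ip w w) = 0" .
  moreover have "l \<noteq> 0"
    by (simp add: l_def)
  ultimately show ?thesis
    unfolding w_def by blast
qed

lemma elt_units_bar_intros:
  "0 \<in> elt_units_bar" "1 \<in> elt_units_bar" "l \<noteq> 0 \<Longrightarrow> Elt l t \<in> elt_units_bar"
  by (auto simp: elt_units_bar_def zero_elt_def one_elt_def)

lemma layer_ip_axis:
  assumes "elt_inner_product ip"
  shows "layer (ip (axis i 1) (axis i 1)) \<noteq> 0"
  by (rule ip_definite[OF assms, of _ i])
    (simp_all add: axis_one_nth elt_units_bar_intros)

text \<open>
  By definiteness the diagonal entries are finite, so a violation can be stated in real numbers
  and \<open>isotropic_combination\<close> applies. For \<open>i \<noteq> j\<close> the isotropic vector has entries \<open>[l]t\<close> and \<open>1\<close>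
  in two different places; for \<open>i = j\<close> the two would be added and their layers might cancel.
\<close>

lemma cauchy_schwarz_axis:
  assumes ip: "elt_inner_product ip"
  shows "tangible (ip (axis i 1) (axis j 1)) + tangible (ip (axis i 1) (axis j 1))
    \<le> tangible (ip (axis i 1) (axis i 1)) + tangible (ip (axis j 1) (axis j 1))"
proof (cases "i = j \<or> ip (axis i 1) (axis j 1) = NegInf")
  case True
  then show ?thesis
    by (cases "ip (axis i 1) (axis j 1)") auto
next
  case False
  then obtain z c where z: "ip (axis i 1) (axis j 1) = Elt z c"
    by (cases "ip (axis i 1) (axis j 1)") auto
  obtain p a where p: "ip (axis i 1) (axis i 1) = Elt p a"
    using layer_ip_axis[OF ip, of i] by (cases "ip (axis i 1) (axis i 1)") auto
  obtain q b where q: "ip (axis j 1) (axis j 1) = Elt q b"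
    using layer_ip_axis[OF ip, of j] by (cases "ip (axis j 1) (axis j 1)") auto
  have "2 * c \<le> a + b"
  proof (rule ccontr)
    assume "\<not> 2 * c \<le> a + b"
    then have "a + b < 2 * c" by simp
    from isotropic_combination[OF ip p q z this] obtain l t where "l \<noteq> 0"
      and iso: "layer (ip (Elt l t *s axis i 1 + axis j 1) (Elt l t *s axis i 1 + axis j 1)) = 0"
      by blast
    have "layer (ip (Elt l t *s axis i 1 + axis j 1) (Elt l t *s axis i 1 + axis j 1)) \<noteq> 0"
    proof (rule ip_definite[OF ip])
      show "(Elt l t *s axis i 1 + axis j 1) $ k \<in> elt_units_bar" for k
        using False \<open>l \<noteq> 0\<close>
        by (simp add: axis_one_nth elt_units_bar_intros)
      show "(Elt l t *s axis i 1 + axis j 1) $ j \<noteq> 0"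
        using False by (auto simp: axis_one_nth)
    qed
    with iso show False by blast
  qed
  then show ?thesis by (simp add: z p q)
qed

section \<open>The Cauchy-Schwarz inequality\<close>

theorem theorem3p6:
  fixes ip :: "elt ^ 'n \<Rightarrow> elt ^ 'n \<Rightarrow> elt" and u v :: "elt ^ 'n"
  assumes "elt_inner_product ip"
  shows "tangible ((ip u v)\<^sup>2) \<le> tangible (ip u u * ip v v)"
proof -
  let ?h = "\<lambda>i j. tangible (ip (axis i 1) (axis j 1))"
  obtain i j where ij: "tangible (ip u v) = tangible (u $ i) + tangible (v $ j) + ?h i j"
    using tangible_ip_attained[OF assms] by blast
  have "tangible ((ip u v)\<^sup>2)
      = (tangible (u $ i) + tangible (u $ i)) + (tangible (v $ j) + tangible (v $ j))
        + (?h i j + ?h i j)"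
    by (simp add: power2_eq_square tangible_times ij ac_simps)
  also have "\<dots> \<le> (tangible (u $ i) + tangible (u $ i)) + (tangible (v $ j) + tangible (v $ j))
        + (?h i i + ?h j j)"
    using cauchy_schwarz_axis[OF assms, of i j] by (intro add_left_mono)
  also have "\<dots> = (tangible (u $ i) + tangible (u $ i) + ?h i i)
      + (tangible (v $ j) + tangible (v $ j) + ?h j j)"
    by (simp add: ac_simps)
  also have "\<dots> \<le> tangible (ip u u) + tangible (ip v v)"
    by (intro add_mono tangible_ip_ge[OF assms])
  finally show ?thesis
    by (simp add: tangible_times)
qed

end
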